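(* Let $p\geq 5$ be a prime and let $r$ be an integer with $1\leq r\leq p-1$ such that $24r+1$ is a quadratic nonresidue modulo $p$. Then for all $n\geq 0$, $d_{p-2}(pn+r)\equiv 0\pmod p$.
   Context: For each integer $k\geq 1$, the numbers $d_k(n)$ are defined by $\sum_{n\geq 0} d_k(n)q^n = \frac{f_2^k}{f_1^{3k+1}}$, where $f_r = \prod_{i\geq 1}(1-q^{ri})$. *)

theory Defs
  imports "HOL-Computational_Algebra.Formal_Power_Series" "HOL-Number_Theory.Number_Theory"
begin

text \<open>The q-series f_r = prod_{i>=1} (1 - q^(r i)) as a formal power series over the rationals.
  Its n-th coefficient agrees with that of the finite product over 1 <= i <= n (for r >= 1,
  the factors with i > n do not affect coefficients of degree <= n).\<close>
definition f_ser :: "nat \<Rightarrow> rat fps" where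
  "f_ser r = Abs_fps (\<lambda>n. fps_nth (\<Prod>i\<in>{1..n}. (1 - fps_X ^ (r * i))) n)"

definition d_coeff :: "nat \<Rightarrow> nat \<Rightarrow> rat" where
  "d_coeff k n = fps_nth (f_ser 2 ^ k / f_ser 1 ^ (3 * k + 1)) n"

end

theory Submission
  imports Defs "HOL-Computational_Algebra.Polynomial"
begin

text \<open>
  Since \<open>3 (p - 2) + 1 = 3 p - 5\<close>, the generating function of \<open>d_{p-2}\<close> is
  \<open>(f_2 / f_1^3)^p * f_1^5 / f_2^2\<close>. The \<open>m\<close>-th coefficient of a \<open>p\<close>-th power \<open>H^p\<close> of an integral
  series is divisible by \<open>p\<close> unless \<open>p dvd m\<close>, because \<open>q (H^p)' = p q H' H^(p-1)\<close>. The second factor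
  is \<open>sum_l (6 l + 1) q^(l (3 l + 1) / 2)\<close> (the derivative at \<open>z = 1\<close> of the quintuple product
  identity), and its exponents \<open>i\<close> satisfy \<open>24 i + 1 = (6 l + 1)^2\<close>, so none of them is congruent
  to \<open>r\<close> modulo \<open>p\<close>.

  The identity for \<open>f_1^5 / f_2^2\<close> is obtained by multiplying the theta series of \<open>f_1^3\<close> (Jacobi) and
  \<open>f_1^2 / f_2\<close> (Gauss), sorting the resulting sum over pairs \<open>(i, j)\<close> by \<open>i + 2 j\<close> and completing the
  square, which splits off the theta series of \<open>f_2\<close> (Euler). The three theta series are limits of the
  finite Jacobi triple product.
\<close>

section \<open>The finite Jacobi triple product\<close>

text \<open>Gaussian binomial coefficients, introduced by Pascal's recurrence so that they exist in
  every commutative ring without division. For \<open>k > m\<close> the truncated exponent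
  \<open>m - k\<close> is harmless because the other factor is 0.\<close>

fun qbinom :: "'a::comm_ring_1 \<Rightarrow> nat \<Rightarrow> nat \<Rightarrow> 'a" where
  "qbinom Q m 0 = 1"
| "qbinom Q 0 (Suc k) = 0"
| "qbinom Q (Suc m) (Suc k) = Q ^ (m - k) * qbinom Q m k + qbinom Q m (Suc k)"

lemma qbinom_eq_0: "m < k \<Longrightarrow> qbinom Q m k = 0"
  by (induction Q m k rule: qbinom.induct) auto

text \<open>The factorial formula, with denominators cleared. In the induction the two Pascal
  summands combine through
  \<open>(1 - Q^(m-k)) + Q^(m-k) * (1 - Q^(k+1)) = 1 - Q^(m+1)\<close>.\<close>

lemma qbinom_mult_prods:
  fixes Q :: "'a::comm_ring_1"
  assumes "k \<le> m"
  shows "qbinom Q m k * (\<Prod>i\<in>{1..k}. 1 - Q ^ i) * (\<Prod>i\<in>{1..m-k}. 1 - Q ^ i) = (\<Prod>i\<in>{1..m}. 1 - Q ^ i)"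
  using assms
proof (induction Q m k rule: qbinom.induct)
  case (3 Q m k)
  define F where "F = (\<lambda>n. \<Prod>i\<in>{1..n}. 1 - Q ^ i)"
  have FS: "F (Suc n) = F n * (1 - Q ^ Suc n)" for n
    by (simp add: F_def)
  have IH1: "qbinom Q m k * F k * F (m - k) = F m"
    using 3 unfolding F_def by simp
  have e1: "qbinom Q m (Suc k) * F (Suc k) * F (m - k) = (1 - Q ^ (m - k)) * F m"
  proof (cases "k < m")
    case True
    have "qbinom Q m (Suc k) * F (Suc k) * F (m - Suc k) = F m"
      using 3 True unfolding F_def by simp
    moreover have "F (m - k) = F (m - Suc k) * (1 - Q ^ (m - k))"
      using FS[of "m - Suc k"] True by (simp add: Suc_diff_Suc)
    ultimately show ?thesis by (metis (no_types, opaque_lifting) mult.assoc mult.commute)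
  next
    case False
    then show ?thesis using 3 by (simp add: qbinom_eq_0)
  qed
  have e2: "Q ^ (m - k) * qbinom Q m k * F (Suc k) * F (m - k)
      = Q ^ (m - k) * (1 - Q ^ Suc k) * F m"
    unfolding FS IH1[symmetric] by (simp add: mult_ac)
  have "qbinom Q (Suc m) (Suc k) * F (Suc k) * F (m - k)
      = (1 - Q ^ (m - k) * Q ^ Suc k) * F m"
    unfolding qbinom.simps distrib_right e1 e2 by (simp add: algebra_simps)
  also have "Q ^ (m - k) * Q ^ Suc k = Q ^ Suc m"
  proof -
    have "m - k + Suc k = Suc m" using 3 by simp
    then show ?thesis by (metis power_add)
  qed
  also have "(1 - Q ^ Suc m) * F m = F (Suc m)"
    by (simp add: FS mult.commute)
  finally show ?case unfolding F_def by simp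
qed auto

text \<open>The q-binomial theorem: splitting off the last factor \<open>y + Q^m x\<close>
  reproduces Pascal's recurrence once \<open>Q^m\<close> is written as
  \<open>Q^(m-k) * Q^k\<close>.\<close>

lemma coeff_q_binomial:
  fixes Q y :: "'a::comm_ring_1"
  shows "coeff (\<Prod>i<m. [:y, Q ^ i:]) k
     = (if k \<le> m then qbinom Q m k * Q ^ (k choose 2) * y ^ (m - k) else 0)"
proof (induction m arbitrary: k)
  case 0
  then show ?case by (simp add: numeral_2_eq_2)
next
  case (Suc m)
  define P where "P = (\<Prod>i<m. [:y, Q ^ i:])"
  have co: "coeff (\<Prod>i<Suc m. [:y, Q ^ i:]) k = y * coeff P k + (case k of 0 \<Rightarrow> 0 | Suc j \<Rightarrow> Q ^ m * coeff P j)"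
    by (simp add: P_def mult.commute[of _ "[:y, Q ^ m:]"] mult_pCons_left coeff_pCons split: nat.split)
  show ?case
  proof (cases k)
    case 0
    then show ?thesis using co Suc.IH[of 0] by (simp add: P_def numeral_2_eq_2)
  next
    case (Suc j)
    have ch: "Suc j choose 2 = (j choose 2) + j"
      by (simp add: numeral_2_eq_2)
    have "coeff (\<Prod>i<Suc m. [:y, Q ^ i:]) k = y * coeff P (Suc j) + Q ^ m * coeff P j"
      using co Suc by simp
    also have "y * coeff P (Suc j) = (if j \<le> m then qbinom Q m (Suc j) * Q ^ (Suc j choose 2) * y ^ (m - j) else 0)"
    proof (cases "j < m")
      case True
      then have "m - j = Suc (m - Suc j)" by simp
      then show ?thesis using Suc.IH[of "Suc j"] True by (simp add: P_def mult_ac)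
    next
      case False
      then show ?thesis using Suc.IH[of "Suc j"] by (simp add: P_def qbinom_eq_0)
    qed
    also have "Q ^ m * coeff P j = (if j \<le> m then Q ^ (m - j) * qbinom Q m j * Q ^ (Suc j choose 2) * y ^ (m - j) else 0)"
    proof (cases "j \<le> m")
      case True
      then have "Q ^ m = Q ^ (m - j) * Q ^ j" by (simp flip: power_add)
      then show ?thesis using Suc.IH[of j] True by (simp add: P_def ch power_add mult_ac)
    qed (use Suc.IH[of j] in \<open>simp add: P_def\<close>)
    finally show ?thesis using Suc by (simp add: algebra_simps)
  qed
qed

lemma prod_lessThan_add:
  fixes f :: "nat \<Rightarrow> 'a::comm_monoid_mult"
  shows "(\<Prod>i<m+n. f i) = (\<Prod>i<m. f i) * (\<Prod>i<n. f (m + i))"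
  by (induction n) (simp_all add: mult.assoc)

text \<open>Put \<open>k = n + j\<close>: the terms linear in \<open>j\<close> cancel except for
  those in \<open>j (j - 1) / 2\<close>, and the rest depends on \<open>n\<close> only. That rest is
  the surplus power to be cancelled in the triple product. Truncation by \<open>nat\<close> loses
  nothing, since \<open>j (j - 1)\<close> is never negative for an integer \<open>j\<close>.\<close>

lemma triangle_exponent:
  assumes "k \<le> 2 * n"
  shows "(k choose 2) + n * (2 * n - k)
       = (\<Sum>i<n. i) + n * n + nat ((int k - int n) * (int k - int n - 1) div 2)"
proof -
  have ch: "2 * int (k choose 2) = int k * (int k - 1)"
  proof -
    have "2 * (k choose 2) = k * (k - 1)" unfolding choose_two by (rule dvd_mult_div_cancel) (cases k, auto)
    then have "int (2 * (k choose 2)) = int (k * (k - 1))" by simp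
    then show ?thesis by (cases k) (auto simp: algebra_simps)
  qed
  have s: "2 * int (\<Sum>i<n. i) = int n * (int n - 1)"
    by (induction n) (auto simp: algebra_simps)
  let ?j = "int k - int n"
  have ev: "even (j * (j - 1))" for j :: int by simp
  have nn: "?j * (?j - 1) \<ge> 0"
    by (cases "?j \<ge> 1") (auto simp: mult_nonneg_nonneg mult_nonpos_nonpos)
  have t: "2 * int (nat (?j * (?j - 1) div 2)) = ?j * (?j - 1)"
    using ev[of ?j] nn by (simp only: int_nat_eq pos_imp_zdiv_nonneg_iff dvd_mult_div_cancel if_True zero_less_numeral)
  have "2 * int ((k choose 2) + n * (2 * n - k))
      = 2 * int ((\<Sum>i<n. i) + n * n + nat (?j * (?j - 1) div 2))"
    unfolding of_nat_add distrib_left ch s t using assms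
    by (simp add: of_nat_diff algebra_simps)
  then show ?thesis by (metis mult_left_cancel of_nat_eq_iff zero_neq_numeral)
qed

text \<open>Substituting \<open>y = Q^n\<close> in the \<open>q\<close>-binomial theorem, instead of rescaling \<open>x\<close> by \<open>Q^(-n)\<close>,
  avoids negative powers of \<open>Q\<close>; the surplus power of \<open>Q\<close> is cancelled afterwards.\<close>
lemma jacobi_triple_product_finite:
  fixes Q :: "'a::idom"
  assumes "Q \<noteq> 0"
  shows "(\<Prod>i<n. [:Q ^ Suc i, 1:]) * (\<Prod>i<n. [:1, Q ^ i:])
    = (\<Sum>k\<le>2*n. monom (qbinom Q (2*n) k * Q ^ nat ((int k - int n) * (int k - int n - 1) div 2)) k)"
    (is "?L = ?R")
proof -
  define C where "C = Q ^ ((\<Sum>i<n. i) + n * n)"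
  \<comment> \<open>The first \<open>n\<close> factors are \<open>Q^i * (Q^(n-i) + x)\<close>, the
    last \<open>n\<close> are \<open>Q^n * (1 + Q^i x)\<close>; the extracted powers multiply to
    \<open>C\<close>.\<close>
  have "(\<Prod>i<2*n. [:Q ^ n, Q ^ i:]) = (\<Prod>i<n. [:Q ^ n, Q ^ i:]) * (\<Prod>i<n. [:Q ^ n, Q ^ (n + i):])"
    by (simp only: mult_2 prod_lessThan_add)
  also have "(\<Prod>i<n. [:Q ^ n, Q ^ (n + i):]) = (\<Prod>i<n. smult (Q ^ n) [:1, Q ^ i:])"
    by (simp add: power_add)
  also have "\<dots> = smult (Q ^ (n * n)) (\<Prod>i<n. [:1, Q ^ i:])"
    by (simp only: prod_smult) (simp add: power_mult)
  also have "(\<Prod>i<n. [:Q ^ n, Q ^ i:]) = (\<Prod>i<n. smult (Q ^ i) [:Q ^ (n - i), 1:])"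
    by (rule prod.cong) (auto simp flip: power_add)
  also have "\<dots> = smult (Q ^ (\<Sum>i<n. i)) (\<Prod>i<n. [:Q ^ (n - i), 1:])"
    by (simp only: prod_smult power_sum)
  also have "(\<Prod>i<n. [:Q ^ (n - i), 1:]) = (\<Prod>i<n. [:Q ^ Suc i, 1:])"
    by (rule prod.reindex_bij_witness[of _ "\<lambda>i. n - Suc i" "\<lambda>i. n - Suc i"]) (auto simp: Suc_diff_Suc)
  finally have L: "(\<Prod>i<2*n. [:Q ^ n, Q ^ i:]) = smult C ?L"
    by (simp only: C_def power_add mult_smult_left mult_smult_right smult_smult mult.commute)
  have R: "(\<Prod>i<2*n. [:Q ^ n, Q ^ i:]) = smult C ?R"
  proof (rule poly_eqI)
    fix k
    show "coeff (\<Prod>i<2*n. [:Q ^ n, Q ^ i:]) k = coeff (smult C ?R) k"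
    proof (cases "k \<le> 2 * n")
      case True
      have "Q ^ (k choose 2) * (Q ^ n) ^ (2 * n - k) = C * Q ^ nat ((int k - int n) * (int k - int n - 1) div 2)"
        unfolding C_def power_mult[symmetric] power_add[symmetric] triangle_exponent[OF True] ..
      then show ?thesis using True
        by (simp add: coeff_q_binomial coeff_sum coeff_monom mult.assoc mult.left_commute sum_distrib_left)
    next
      case False
      then show ?thesis by (simp add: coeff_q_binomial coeff_sum coeff_monom)
    qed
  qed
  have "C \<noteq> 0" using assms by (simp add: C_def)
  then show ?thesis using trans[OF L[symmetric] R] by (rule smult_cancel)
qed

section \<open>Theta series as limits of finite products\<close>

definition altsign :: "int \<Rightarrow> rat" where
  "altsign j = (if even j then 1 else -1)"

text \<open>An arbitrary index type allows series over pairs, hence products of theta series. A sum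
  over an infinite fibre is 0 by convention, so finiteness of the fibres has to be secured where it
  matters.\<close>

definition theta :: "('a \<Rightarrow> nat) \<Rightarrow> ('a \<Rightarrow> rat) \<Rightarrow> rat fps" where
  "theta e w = Abs_fps (\<lambda>N. \<Sum>j\<in>{j. e j = N}. w j)"

text \<open>Congruence modulo \<open>X^(N+1)\<close>; it replaces convergence of power series
  throughout.\<close>

definition fps_eq_upto :: "nat \<Rightarrow> 'a::zero fps \<Rightarrow> 'a fps \<Rightarrow> bool" where
  "fps_eq_upto N f g \<longleftrightarrow> (\<forall>k\<le>N. fps_nth f k = fps_nth g k)"

lemma fps_eq_upto_refl [simp]: "fps_eq_upto N f f"
  by (simp add: fps_eq_upto_def)

lemma fps_eq_upto_sym: "fps_eq_upto N f g \<Longrightarrow> fps_eq_upto N g f"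
  by (simp add: fps_eq_upto_def)

lemma fps_eq_upto_trans [trans]: "fps_eq_upto N f g \<Longrightarrow> fps_eq_upto N g h \<Longrightarrow> fps_eq_upto N f h"
  by (simp add: fps_eq_upto_def)

lemma fps_eq_upto_mult:
  fixes f g :: "'a::semiring_0 fps"
  assumes "fps_eq_upto N f f'" "fps_eq_upto N g g'"
  shows "fps_eq_upto N (f * g) (f' * g')"
  using assms by (auto simp: fps_eq_upto_def fps_mult_nth intro!: sum.cong)

lemma fps_eq_upto_power:
  fixes f :: "'a::semiring_1 fps"
  shows "fps_eq_upto N f f' \<Longrightarrow> fps_eq_upto N (f ^ k) (f' ^ k)"
  by (induction k) (auto intro: fps_eq_upto_mult)

lemma fps_eq_upto_sum:
  fixes f :: "'b \<Rightarrow> 'a::comm_monoid_add fps"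
  shows "(\<And>x. x \<in> A \<Longrightarrow> fps_eq_upto N (f x) (g x)) \<Longrightarrow> fps_eq_upto N (sum f A) (sum g A)"
  by (auto simp: fps_eq_upto_def fps_sum_nth intro!: sum.cong)

lemma fps_eqI_upto: "(\<And>N. fps_eq_upto N f g) \<Longrightarrow> f = g"
  by (auto simp: fps_eq_upto_def fps_eq_iff)

lemma fps_eq_upto_mult_cancel:
  fixes f :: "'a::field fps"
  assumes "fps_eq_upto N (f * g) (f * h)" "fps_nth f 0 \<noteq> 0"
  shows "fps_eq_upto N g h"
proof -
  have "fps_eq_upto N (inverse f * (f * g)) (inverse f * (f * h))"
    using assms(1) by (rule fps_eq_upto_mult[OF fps_eq_upto_refl])
  moreover have "inverse f * (f * x) = x" for x
    using inverse_mult_eq_1[OF assms(2)] by (metis mult.assoc mult_1)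
  ultimately show ?thesis by (simp only:)
qed

lemma fps_eq_upto_f_ser:
  assumes "r > 0" "N \<le> n"
  shows "fps_eq_upto N (\<Prod>i\<in>{1..n}. 1 - fps_X ^ (r * i)) (f_ser r)"
proof -
  have step: "fps_eq_upto k (\<Prod>i\<in>{1..n}. 1 - fps_X ^ (r * i)) (\<Prod>i\<in>{1..k}. 1 - fps_X ^ (r * i) :: rat fps)"
    if "k \<le> n" for k n
    using that
  proof (induction n rule: dec_induct)
    case (step n)
    have "r * Suc n > k" using assms(1) step.hyps(1) mult_le_mono1[of 1 r "Suc n"] by simp
    then have "fps_eq_upto k (1 - fps_X ^ (r * Suc n)) (1 :: rat fps)"
      by (auto simp: fps_eq_upto_def)
    from fps_eq_upto_mult[OF step.IH this] show ?case by simp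
  qed simp
  show ?thesis unfolding fps_eq_upto_def f_ser_def
    using step assms unfolding fps_eq_upto_def by fastforce
qed

lemma f_ser_nth_0 [simp]: "fps_nth (f_ser r) 0 = 1"
  by (simp add: f_ser_def)

text \<open>Far from both ends a Gaussian binomial looks like \<open>1 / f_a\<close>: since
  \<open>k\<close>, \<open>m - k\<close> and \<open>m\<close> are all at least \<open>N\<close>, the
  three products in the factorial formula agree with \<open>f_a\<close> up to degree
  \<open>N\<close>, and one copy of \<open>f_a\<close> cancels.\<close>

lemma fps_eq_upto_qbinom:
  assumes "a > 0" "N \<le> k" "N + k \<le> m"
  shows "fps_eq_upto N (f_ser a * qbinom (fps_X ^ a) m k) 1"
proof -
  define F where "F = (\<lambda>n. \<Prod>i\<in>{1..n}. 1 - (fps_X ^ a) ^ i :: rat fps)"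
  have F: "fps_eq_upto N (F n) (f_ser a)" if "N \<le> n" for n
    using fps_eq_upto_f_ser[OF assms(1) that] by (simp add: F_def power_mult)
  have "qbinom (fps_X ^ a) m k * F k * F (m - k) = F m"
    unfolding F_def using assms by (intro qbinom_mult_prods) auto
  moreover have "fps_eq_upto N (qbinom (fps_X ^ a) m k * F k * F (m - k)) (qbinom (fps_X ^ a) m k * f_ser a * f_ser a)"
    using assms by (intro fps_eq_upto_mult F) auto
  moreover have "fps_eq_upto N (F m) (f_ser a)" using assms by (intro F) auto
  ultimately have "fps_eq_upto N (qbinom (fps_X ^ a) m k * f_ser a * f_ser a) (f_ser a)"
    by (metis fps_eq_upto_sym fps_eq_upto_trans)
  then have "fps_eq_upto N (f_ser a * (f_ser a * qbinom (fps_X ^ a) m k)) (f_ser a * 1)"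
    by (simp add: mult_ac)
  then show ?thesis by (rule fps_eq_upto_mult_cancel) simp
qed

text \<open>Indices with \<open>e j > N\<close> contribute nothing up to degree \<open>N\<close>.
  The growth condition on \<open>e\<close> confines the others to \<open>|j| <= N + 1\<close>, and
  \<open>n >= 2 N + 1\<close> then keeps both \<open>k = n + j\<close> and \<open>2 n - k\<close> at
  least \<open>N\<close>, where \<open>f_a\<close> cancels the Gaussian binomial.\<close>

lemma theta_limit:
  fixes e :: "int \<Rightarrow> nat"
  assumes "a > 0" and e: "\<And>j. \<bar>j\<bar> \<le> int (e j) + 1" and n: "n \<ge> 2 * N + 1"
  shows "fps_eq_upto N (f_ser a * (\<Sum>k\<le>2*n. qbinom (fps_X ^ a) (2*n) k
           * (fps_const (w (int k - int n)) * fps_X ^ e (int k - int n)))) (theta e w)"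
proof -
  have "fps_eq_upto N (f_ser a * (\<Sum>k\<le>2*n. qbinom (fps_X ^ a) (2*n) k
           * (fps_const (w (int k - int n)) * fps_X ^ e (int k - int n))))
         (\<Sum>k\<le>2*n. fps_const (w (int k - int n)) * fps_X ^ e (int k - int n))"
    unfolding sum_distrib_left mult.assoc[symmetric, of "f_ser a"]
  proof (rule fps_eq_upto_sum)
    fix k assume k: "k \<in> {..2*n}"
    let ?j = "int k - int n"
    let ?t = "fps_const (w ?j) * fps_X ^ e ?j"
    show "fps_eq_upto N (f_ser a * qbinom (fps_X ^ a) (2*n) k * ?t) ?t"
    proof (cases "e ?j \<le> N")
      case True
      with e[of ?j] have "\<bar>?j\<bar> \<le> int N + 1" by linarith
      with n have "N \<le> k" "N + k \<le> 2 * n" by linarith+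
      from fps_eq_upto_mult[OF fps_eq_upto_qbinom[OF \<open>a > 0\<close> this] fps_eq_upto_refl[of N ?t]]
      show ?thesis by (simp only: mult_1)
    next
      case False
      then have t0: "fps_eq_upto N ?t 0" by (auto simp: fps_eq_upto_def)
      have "fps_eq_upto N (f_ser a * qbinom (fps_X ^ a) (2*n) k * ?t) 0"
        using fps_eq_upto_mult[OF fps_eq_upto_refl t0] by (simp only: mult_zero_right)
      with t0 show ?thesis by (blast intro: fps_eq_upto_sym fps_eq_upto_trans)
    qed
  qed
  also have "fps_eq_upto N (\<Sum>k\<le>2*n. fps_const (w (int k - int n)) * fps_X ^ e (int k - int n)) (theta e w)"
    unfolding fps_eq_upto_def
  proof (intro allI impI)
    fix M assume M: "M \<le> N"
    have "fps_nth (\<Sum>k\<le>2*n. fps_const (w (int k - int n)) * fps_X ^ e (int k - int n)) M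
       = (\<Sum>k\<le>2*n. if e (int k - int n) = M then w (int k - int n) else 0)"
      by (auto simp: fps_sum_nth intro!: sum.cong)
    also have "\<dots> = (\<Sum>k\<in>{k\<in>{..2*n}. e (int k - int n) = M}. w (int k - int n))"
      by (rule sum.inter_filter[symmetric]) simp
    also have "\<dots> = (\<Sum>j\<in>{j. e j = M}. w j)"
    proof (rule sum.reindex_bij_witness[of _ "\<lambda>j. nat (j + int n)" "\<lambda>k. int k - int n"])
      fix j assume j: "j \<in> {j. e j = M}"
      with e[of j] M n have "\<bar>j\<bar> \<le> int n" by auto
      with j show "int (nat (j + int n)) - int n = j" "nat (j + int n) \<in> {k\<in>{..2*n}. e (int k - int n) = M}"
        by auto
    qed auto
    finally show "fps_nth (\<Sum>k\<le>2*n. fps_const (w (int k - int n)) * fps_X ^ e (int k - int n)) M = fps_nth (theta e w) M"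
      by (simp add: theta_def)
  qed
  finally show ?thesis .
qed

lemma triangle_int: "2 * (j * (j - 1) div 2) = j * (j - 1 :: int)"
  by simp

text \<open>The finite triple product at \<open>Q = q^a\<close>, \<open>x = - q^b\<close>, after
  cancelling \<open>(- q^b)^n\<close> on both sides. The condition \<open>0 < b < a\<close> makes
  the natural-number subtraction exact and the exponents \<open>e j\<close> nonnegative.\<close>

lemma jtp_finite:
  fixes a b n :: nat
  defines "e \<equiv> \<lambda>j. nat (int a * (j * (j - 1) div 2) + int b * j)"
  assumes ab: "0 < b" "b < a"
  shows "(\<Prod>i<n. 1 - fps_X ^ (a * Suc i - b)) * (\<Prod>i<n. 1 - fps_X ^ (b + a * i))
    = (\<Sum>k\<le>2*n. qbinom (fps_X ^ a) (2*n) k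
           * (fps_const (altsign (int k - int n)) * fps_X ^ e (int k - int n)))"
    (is "?L = ?R")
proof -
  let ?q = "fps_X :: rat fps"
  have e_int: "int (e j) = int a * (j * (j - 1) div 2) + int b * j" for j
  proof -
    have "2 * (int a * (j * (j - 1) div 2) + int b * j) = j * (int a * (j - 1) + 2 * int b)"
      using triangle_int[of j] by (simp add: algebra_simps)
    also have "\<dots> \<ge> 0"
    proof (cases "j \<ge> 0")
      case True
      then have "j = 0 \<or> j \<ge> 1" by linarith
      then show ?thesis by auto
    next
      case False
      then have "int a * (j - 1) \<le> int a * (-2)" by (intro mult_left_mono) auto
      then show ?thesis using False ab by (intro mult_nonpos_nonpos) auto
    qed
    finally show ?thesis unfolding e_def by simp
  qed
  have "poly ((\<Prod>i<n. [:(?q ^ a) ^ Suc i, 1:]) * (\<Prod>i<n. [:1, (?q ^ a) ^ i:])) (- (?q ^ b))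
     = (\<Prod>i<n. ?q ^ (a * Suc i) - ?q ^ b) * (\<Prod>i<n. 1 - ?q ^ (b + a * i))"
    by (simp add: poly_prod power_mult power_add)
  also have "(\<Prod>i<n. ?q ^ (a * Suc i) - ?q ^ b) = (\<Prod>i<n. - (?q ^ b) * (1 - ?q ^ (a * Suc i - b)))"
  proof (rule prod.cong)
    fix i
    have "b \<le> a * Suc i" using ab by (simp add: trans_le_add1)
    then have "?q ^ (a * Suc i) = ?q ^ b * ?q ^ (a * Suc i - b)"
      by (simp flip: power_add)
    then show "?q ^ (a * Suc i) - ?q ^ b = - (?q ^ b) * (1 - ?q ^ (a * Suc i - b))"
      by (simp add: algebra_simps)
  qed simp
  also have "\<dots> = (- (?q ^ b)) ^ n * (\<Prod>i<n. 1 - ?q ^ (a * Suc i - b))"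
    by (simp only: prod.distrib) simp
  finally have L: "poly ((\<Prod>i<n. [:(?q ^ a) ^ Suc i, 1:]) * (\<Prod>i<n. [:1, (?q ^ a) ^ i:])) (- (?q ^ b))
     = (- (?q ^ b)) ^ n * ?L" by (simp add: mult.assoc)
  have R: "poly (\<Sum>k\<le>2*n. monom (qbinom (?q ^ a) (2*n) k * (?q ^ a) ^ nat ((int k - int n) * (int k - int n - 1) div 2)) k) (- (?q ^ b))
     = (- (?q ^ b)) ^ n * ?R"
    unfolding poly_sum poly_monom sum_distrib_left
  proof (rule sum.cong)
    fix k
    let ?j = "int k - int n"
    have nn: "?j * (?j - 1) \<ge> 0"
      by (cases "?j \<ge> 1") (auto simp: mult_nonneg_nonneg mult_nonpos_nonpos)
    have "int (a * nat (?j * (?j - 1) div 2) + b * k) = int (b * n + e ?j)"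
      using nn by (simp add: e_int algebra_simps)
    then have ex: "a * nat (?j * (?j - 1) div 2) + b * k = b * n + e ?j" by linarith
    have sg: "(- 1 :: rat fps) ^ k = (- 1) ^ n * fps_const (altsign ?j)"
      by (auto simp: altsign_def minus_one_power_iff simp flip: fps_const_neg)
    have "(?q ^ a) ^ nat (?j * (?j - 1) div 2) * (- (?q ^ b)) ^ k
        = (- 1) ^ k * ?q ^ (a * nat (?j * (?j - 1) div 2) + b * k)"
      by (simp add: power_minus[of "?q ^ b"] power_add power_mult)
    also have "\<dots> = (- (?q ^ b)) ^ n * (fps_const (altsign ?j) * ?q ^ e ?j)"
      unfolding ex sg by (simp add: power_minus[of "?q ^ b"] power_add power_mult)
    finally show "qbinom (?q ^ a) (2*n) k * (?q ^ a) ^ nat (?j * (?j - 1) div 2) * (- (?q ^ b)) ^ k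
       = (- (?q ^ b)) ^ n * (qbinom (?q ^ a) (2*n) k * (fps_const (altsign ?j) * ?q ^ e ?j))"
      by (simp only: mult.assoc mult.left_commute[of _ "qbinom (?q ^ a) (2*n) k"])
  qed simp
  have "(- (?q ^ b)) ^ n * ?L = (- (?q ^ b)) ^ n * ?R"
    unfolding L[symmetric] R[symmetric] by (subst jacobi_triple_product_finite) auto
  then show ?thesis by simp
qed

lemma theta_reindex:
  assumes "bij h"
  shows "theta (\<lambda>x. e (h x)) (\<lambda>x. w (h x)) = theta e w"
proof -
  have "(\<Sum>x\<in>{x. e (h x) = N}. w (h x)) = (\<Sum>y\<in>{y. e y = N}. w y)" for N
    by (rule sum.reindex_bij_witness[of _ "inv_into UNIV h" h])
       (use assms in \<open>auto simp: bij_is_inj bij_is_surj surj_f_inv_f\<close>)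
  then show ?thesis by (simp add: theta_def)
qed

lemma finite_fibre:
  fixes e :: "int \<Rightarrow> nat"
  assumes "\<And>j. \<bar>j\<bar> \<le> int (e j) + 1"
  shows "finite {j. e j = N}"
proof (rule finite_subset)
  show "{j. e j = N} \<subseteq> {- (int N + 1)..int N + 1}"
  proof
    fix j assume "j \<in> {j. e j = N}"
    then show "j \<in> {- (int N + 1)..int N + 1}" using assms[of j] by auto
  qed
qed simp

lemma theta_mult:
  fixes e :: "'a \<Rightarrow> nat" and e' :: "'b \<Rightarrow> nat"
  assumes "\<And>N. finite {x. e x = N}" "\<And>N. finite {y. e' y = N}"
  shows "theta e w * theta e' w' = theta (\<lambda>(x, y). e x + e' y) (\<lambda>(x, y). w x * w' y)"
proof (rule fps_ext)
  fix N
  have "fps_nth (theta e w * theta e' w') N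
      = (\<Sum>i=0..N. \<Sum>p\<in>{x. e x = i} \<times> {y. e' y = N - i}. w (fst p) * w' (snd p))"
    by (simp add: fps_mult_nth theta_def sum_product sum.cartesian_product case_prod_unfold)
  also have "\<dots> = (\<Sum>q\<in>(SIGMA i:{0..N}. {x. e x = i} \<times> {y. e' y = N - i}). w (fst (snd q)) * w' (snd (snd q)))"
    using assms by (subst sum.Sigma) (auto simp: case_prod_unfold)
  also have "\<dots> = (\<Sum>p\<in>{(x, y). e x + e' y = N}. w (fst p) * w' (snd p))"
    by (rule sum.reindex_bij_witness[of _ "\<lambda>p. (e (fst p), p)" snd]) auto
  finally show "fps_nth (theta e w * theta e' w') N
      = fps_nth (theta (\<lambda>(x, y). e x + e' y) (\<lambda>(x, y). w x * w' y)) N"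
    by (simp add: theta_def case_prod_unfold)
qed

lemma int_abs_le_square: "\<bar>j\<bar> \<le> j * j" for j :: int
proof -
  have "j = 0 \<or> 1 \<le> \<bar>j\<bar>" by linarith
  then show ?thesis using mult_left_mono[of 1 "\<bar>j\<bar>" "\<bar>j\<bar>"] by auto
qed

text \<open>For positive \<open>j\<close> this is \<open>(j - 1) (j - 2) >= 0\<close>, with equality
  at 1 and 2; these two values force the \<open>+ 1\<close> in the growth condition on
  exponents.\<close>

lemma int_bound_triangle: "\<bar>j\<bar> \<le> int (nat (j * (j - 1) div 2)) + 1" for j :: int
proof -
  have "0 \<le> (j - 1) * (j - 2)"
    by (cases "j \<ge> 2") (auto intro: mult_nonpos_nonpos)
  moreover note int_abs_le_square[of j]
  ultimately have "2 * \<bar>j\<bar> \<le> j * (j - 1) + 2"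
    by (cases "j \<ge> 0") (simp_all add: algebra_simps)
  then show ?thesis by linarith
qed

text \<open>The first factor stays a finite product rather than \<open>f_ser a\<close>, so that in
  the applications all three products can be merged by induction on \<open>n\<close> before the
  limit is taken.\<close>

lemma jtp_limit:
  fixes a b :: nat and e :: "int \<Rightarrow> nat"
  assumes ab: "0 < b" "b < a" and n: "n \<ge> 2 * N + 1"
    and e: "\<And>j. int (e j) = int a * (j * (j - 1) div 2) + int b * j" "\<And>j. \<bar>j\<bar> \<le> int (e j) + 1"
  shows "fps_eq_upto N ((\<Prod>i\<in>{1..n}. 1 - fps_X ^ (a * i)) * ((\<Prod>i<n. 1 - fps_X ^ (a * Suc i - b)) * (\<Prod>i<n. 1 - fps_X ^ (b + a * i))))
     (theta e altsign)"
proof -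
  have ee: "(\<lambda>j. nat (int a * (j * (j - 1) div 2) + int b * j)) = e"
    by (simp flip: e(1))
  have "fps_eq_upto N ((\<Prod>i\<in>{1..n}. 1 - fps_X ^ (a * i)) * ((\<Prod>i<n. 1 - fps_X ^ (a * Suc i - b)) * (\<Prod>i<n. 1 - fps_X ^ (b + a * i))))
     (f_ser a * ((\<Prod>i<n. 1 - fps_X ^ (a * Suc i - b)) * (\<Prod>i<n. 1 - fps_X ^ (b + a * i))))"
    by (rule fps_eq_upto_mult[OF fps_eq_upto_f_ser fps_eq_upto_refl]) (use ab n in auto)
  also have "fps_eq_upto N \<dots> (theta e altsign)"
    unfolding jtp_finite[OF ab] ee[THEN fun_cong] using ab e(2) n by (intro theta_limit) auto
  finally show ?thesis .
qed

text \<open>The triple product with \<open>a = 6\<close>, \<open>b = 2\<close>: exponents congruent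
  to 0, 4 and 2 modulo 6 together run through all even numbers.\<close>

lemma euler_pentagonal:
  "theta (\<lambda>j. nat (3 * j * j - j)) altsign = f_ser 2"
proof (rule fps_eqI_upto)
  fix N :: nat
  define n where "n = 2 * N + 1"
  have nn: "\<bar>j\<bar> \<le> 3 * j * j - j" for j :: int
    using int_abs_le_square[of j] by linarith
  have eq: "(\<Prod>i\<in>{1..n}. 1 - fps_X ^ (6 * i)) * ((\<Prod>i<n. 1 - fps_X ^ (6 * Suc i - 2)) * (\<Prod>i<n. 1 - fps_X ^ (2 + 6 * i)))
      = (\<Prod>i\<in>{1..3*n}. 1 - fps_X ^ (2 * i) :: rat fps)" for n
  proof (induction n)
    case (Suc n)
    have "3 * Suc n = Suc (Suc (Suc (3 * n)))" by simp
    then have "(\<Prod>i\<in>{1..3*Suc n}. 1 - fps_X ^ (2 * i) :: rat fps)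
      = (\<Prod>i\<in>{1..3*n}. 1 - fps_X ^ (2 * i)) * (1 - fps_X ^ (2 * Suc (3 * n)))
          * (1 - fps_X ^ (2 * Suc (Suc (3 * n)))) * (1 - fps_X ^ (2 * Suc (Suc (Suc (3 * n)))))"
      by (simp only: prod.nat_ivl_Suc')  (simp add: mult_ac)
    also have "2 * Suc (3 * n) = 2 + 6 * n" by simp
    also have "2 * Suc (Suc (3 * n)) = 6 * Suc n - 2" by simp
    also have "2 * Suc (Suc (Suc (3 * n))) = 6 * Suc n" by simp
    finally have "(\<Prod>i\<in>{1..3*Suc n}. 1 - fps_X ^ (2 * i) :: rat fps)
      = (\<Prod>i\<in>{1..3*n}. 1 - fps_X ^ (2 * i)) * (1 - fps_X ^ (2 + 6 * n)) * (1 - fps_X ^ (6 * Suc n - 2)) * (1 - fps_X ^ (6 * Suc n))" .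
    then show ?case unfolding Suc.IH[symmetric] by (simp add: mult_ac)
  qed simp
  have lim: "fps_eq_upto N ((\<Prod>i\<in>{1..n}. 1 - fps_X ^ (6 * i)) * ((\<Prod>i<n. 1 - fps_X ^ (6 * Suc i - 2)) * (\<Prod>i<n. 1 - fps_X ^ (2 + 6 * i))))
     (theta (\<lambda>j. nat (3 * j * j - j)) altsign)"
  proof (rule jtp_limit)
    fix j :: int
    have "3 * j * j - j = 3 * (j * (j - 1)) + 2 * j" by (simp add: algebra_simps)
    also have "\<dots> = 3 * (2 * (j * (j - 1) div 2)) + 2 * j" by (simp only: triangle_int)
    finally show "int (nat (3 * j * j - j)) = int 6 * (j * (j - 1) div 2) + int 2 * j"
      using nn[of j] by simp
    show "\<bar>j\<bar> \<le> int (nat (3 * j * j - j)) + 1" using nn[of j] by linarith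
  qed (auto simp: n_def)
  have f2: "fps_eq_upto N (\<Prod>i\<in>{1..3*n}. 1 - fps_X ^ (2 * i)) (f_ser 2)"
    by (rule fps_eq_upto_f_ser) (auto simp: n_def)
  show "fps_eq_upto N (theta (\<lambda>j. nat (3 * j * j - j)) altsign) (f_ser 2)"
    using fps_eq_upto_trans[OF fps_eq_upto_sym[OF lim[unfolded eq]] f2] .
qed

text \<open>The triple product with \<open>a = 2\<close>, \<open>b = 1\<close> contains every even
  exponent once and every odd exponent twice; one more factor \<open>f_2\<close> completes it to the
  square of \<open>f_1\<close>.\<close>

lemma gauss_square:
  "theta (\<lambda>j. nat (j * j)) altsign * f_ser 2 = f_ser 1 ^ 2"
proof (rule fps_eqI_upto)
  fix N :: nat
  define n where "n = 2 * N + 1"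
  define P where "P = (\<lambda>n. (\<Prod>i\<in>{1..n}. 1 - fps_X ^ (2 * i)) * ((\<Prod>i<n. 1 - fps_X ^ (2 * Suc i - 1)) * (\<Prod>i<n. 1 - fps_X ^ (1 + 2 * i))) :: rat fps)"
  have eq: "P n * (\<Prod>i\<in>{1..n}. 1 - fps_X ^ (2 * i)) = (\<Prod>i\<in>{1..2*n}. 1 - fps_X ^ (1 * i)) ^ 2" for n
  proof (induction n)
    case (Suc n)
    have "2 * Suc n = Suc (Suc (2 * n))" by simp
    then have "(\<Prod>i\<in>{1..2*Suc n}. 1 - fps_X ^ (1 * i) :: rat fps)
      = (\<Prod>i\<in>{1..2*n}. 1 - fps_X ^ (1 * i)) * (1 - fps_X ^ (1 + 2 * n)) * (1 - fps_X ^ (2 * Suc n))"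
      by simp
    then have sq: "(\<Prod>i\<in>{1..2*Suc n}. 1 - fps_X ^ (1 * i) :: rat fps) ^ 2
      = (\<Prod>i\<in>{1..2*n}. 1 - fps_X ^ (1 * i)) ^ 2 * ((1 - fps_X ^ (1 + 2 * n)) * (1 - fps_X ^ (2 * Suc n))) ^ 2"
      by (simp only: power_mult_distrib mult_ac)
    show ?case unfolding sq Suc.IH[symmetric]
      by (simp add: P_def power2_eq_square mult_ac)
  qed (simp add: P_def)
  have lim: "fps_eq_upto N (P n) (theta (\<lambda>j. nat (j * j)) altsign)"
    unfolding P_def
  proof (rule jtp_limit)
    fix j :: int
    show "int (nat (j * j)) = int 2 * (j * (j - 1) div 2) + int 1 * j"
      using triangle_int[of j] by (simp add: algebra_simps)
    show "\<bar>j\<bar> \<le> int (nat (j * j)) + 1" using int_abs_le_square[of j] by linarith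
  qed (auto simp: n_def)
  have f2: "fps_eq_upto N (\<Prod>i\<in>{1..n}. 1 - fps_X ^ (2 * i)) (f_ser 2)"
    by (rule fps_eq_upto_f_ser) (auto simp: n_def)
  have f1: "fps_eq_upto N (\<Prod>i\<in>{1..2*n}. 1 - fps_X ^ (1 * i)) (f_ser 1)"
    by (rule fps_eq_upto_f_ser) (auto simp: n_def)
  show "fps_eq_upto N (theta (\<lambda>j. nat (j * j)) altsign * f_ser 2) (f_ser 1 ^ 2)"
    using fps_eq_upto_trans[OF fps_eq_upto_sym[OF fps_eq_upto_mult[OF lim f2]]] fps_eq_upto_power[OF f1, of 2]
    unfolding eq by blast
qed

text \<open>The derivative of the finite triple product at its root \<open>x = -1\<close>.\<close>
lemma jacobi_finite:
  fixes m :: nat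
  defines "n \<equiv> Suc m"
  shows "(\<Prod>i\<in>{1..n}. 1 - fps_X ^ i) * (\<Prod>i\<in>{1..m}. 1 - fps_X ^ i)
    = (\<Sum>k\<le>2*n. qbinom fps_X (2*n) k * (fps_const (- altsign (int k - int n) * of_int (int k - int n))
         * fps_X ^ nat ((int k - int n) * (int k - int n - 1) div 2)))" (is "?L = ?S")
proof -
  let ?q = "fps_X :: rat fps"
  define c where "c = (\<lambda>k. qbinom ?q (2*n) k * ?q ^ nat ((int k - int n) * (int k - int n - 1) div 2))"
  \<comment> \<open>\<open>R\<close> is the triple product without its factor \<open>1 + x\<close>.
    By the product rule, the derivative of \<open>(1 + x) R\<close> at \<open>x = -1\<close> is just
    the value of \<open>R\<close> there.\<close>
  define R where "R = (\<Prod>i<n. [:?q ^ Suc i, 1:]) * (\<Prod>i<m. [:1, ?q ^ Suc i:])"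
  have F: "(\<Prod>i\<in>{1..k}. 1 - ?q ^ i) = (\<Prod>i<k. 1 - ?q ^ Suc i)" for k
    by (induction k) auto
  have "(\<Prod>i<n. [:1, ?q ^ i:]) = [:1, 1:] * (\<Prod>i<m. [:1, ?q ^ Suc i:])"
    unfolding n_def prod.lessThan_Suc_shift by simp
  then have eq: "[:1, 1:] * R = (\<Sum>k\<le>2*n. monom (c k) k)"
    using jacobi_triple_product_finite[of ?q n] unfolding R_def c_def by (simp only: mult_ac fps_X_neq_zero) simp
  have "poly R (-1) = (\<Prod>i<n. ?q ^ Suc i - 1) * (\<Prod>i<m. 1 - ?q ^ Suc i)"
    by (simp add: R_def poly_prod)
  also have "(\<Prod>i<n. ?q ^ Suc i - 1) = (\<Prod>i<n. (-1) * (1 - ?q ^ Suc i))"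
    by (rule prod.cong) auto
  also have "\<dots> = (-1) ^ n * (\<Prod>i<n. 1 - ?q ^ Suc i)"
    by (simp only: prod.distrib) simp
  finally have RL: "poly R (-1) = (-1) ^ n * ?L" by (simp only: F mult.assoc)
  have V: "(\<Sum>k\<le>2*n. c k * (-1) ^ k) = 0"
    using arg_cong[OF eq, of "\<lambda>p. poly p (-1)"] by (simp add: poly_sum poly_monom)
  have "poly (pderiv ([:1, 1:] * R)) (-1) = poly R (-1)"
    by (simp only: pderiv_mult) (simp add: pderiv_pCons)
  then have D: "(\<Sum>k\<le>2*n. of_nat k * c k * (-1) ^ (k - 1)) = poly R (-1)"
    unfolding eq higher_pderiv_sum[of 1, simplified] by (simp add: poly_sum poly_monom pderiv_monom)
  \<comment> \<open>Differentiation produces the weight \<open>k\<close>. Because the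
    undifferentiated sum vanishes at \<open>x = -1\<close> (fact \<open>V\<close>), a multiple of it
    may be added to shift the weight to \<open>k - n\<close>.\<close>
  have "(-1) ^ n * ?S = (\<Sum>k\<le>2*n. of_nat k * c k * (-1) ^ (k - 1) + of_nat n * (c k * (-1) ^ k))"
    unfolding sum_distrib_left
  proof (rule sum.cong)
    fix k
    let ?j = "int k - int n"
    have "(-1) ^ n * fps_const (- altsign ?j * of_int ?j) = - ((-1) ^ k * (of_nat k - of_nat n :: rat fps))"
      by (auto simp: altsign_def minus_one_power_iff fps_of_nat[symmetric])
    also have "\<dots> = of_nat k * (-1) ^ (k - 1) + of_nat n * (-1) ^ k"
      by (cases k) (auto simp: algebra_simps)
    finally have s: "(-1) ^ n * fps_const (- altsign ?j * of_int ?j) = of_nat k * (-1) ^ (k - 1) + (of_nat n * (-1) ^ k :: rat fps)" .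
    have "(-1) ^ n * (qbinom ?q (2*n) k * (fps_const (- altsign ?j * of_int ?j) * ?q ^ nat (?j * (?j - 1) div 2)))
       = ((-1) ^ n * fps_const (- altsign ?j * of_int ?j)) * c k"
      unfolding c_def by (simp only: mult_ac)
    then show "(-1) ^ n * (qbinom ?q (2*n) k * (fps_const (- altsign ?j * of_int ?j) * ?q ^ nat (?j * (?j - 1) div 2)))
       = of_nat k * c k * (-1) ^ (k - 1) + of_nat n * (c k * (-1) ^ k)"
      unfolding s by (simp only: distrib_right) (simp only: mult_ac)
  qed simp
  also have "\<dots> = (-1) ^ n * ?L"
    unfolding sum.distrib sum_distrib_left[symmetric] V D RL by simp
  finally show ?thesis by simp
qed

text \<open>Jacobi's identity as a sum over all integers: pairing \<open>i\<close> with
  \<open>- 1 - i\<close> recovers the familiar coefficients \<open>(-1)^i (2 i + 1)\<close> for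
  \<open>i >= 0\<close>. The finite form supplies two factors \<open>f_1\<close>, and the third
  removes the Gaussian binomials.\<close>

lemma jacobi_cube:
  "theta (\<lambda>i. nat (i * (i + 1) div 2)) (\<lambda>i. altsign i * of_int i) = f_ser 1 ^ 3"
proof -
  define e :: "int \<Rightarrow> nat" where "e = (\<lambda>j. nat (j * (j - 1) div 2))"
  define w :: "int \<Rightarrow> rat" where "w = (\<lambda>j. - altsign j * of_int j)"
  have "theta (\<lambda>i. e (- i)) (\<lambda>i. w (- i)) = theta e w"
    by (rule theta_reindex) (rule bij_uminus)
  moreover have "(\<lambda>i. e (- i)) = (\<lambda>i. nat (i * (i + 1) div 2))"
    by (auto simp: e_def algebra_simps)
  moreover have "(\<lambda>i. w (- i)) = (\<lambda>i. altsign i * of_int i)"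
    by (auto simp: w_def altsign_def)
  moreover have "theta e w = f_ser 1 ^ 3"
  proof (rule fps_eqI_upto)
    fix N :: nat
    \<comment> \<open>With this choice \<open>Suc m\<close> is exactly the bound
      \<open>2 * N + 1\<close> demanded by \<open>theta_limit\<close>.\<close>
    define m where "m = 2 * N"
    have "fps_eq_upto N (f_ser 1 * (\<Sum>k\<le>2*Suc m. qbinom (fps_X ^ 1) (2*Suc m) k
           * (fps_const (w (int k - int (Suc m))) * fps_X ^ e (int k - int (Suc m))))) (theta e w)"
      by (rule theta_limit) (use int_bound_triangle in \<open>auto simp: m_def e_def\<close>)
    then have "fps_eq_upto N (f_ser 1 * ((\<Prod>i\<in>{1..Suc m}. 1 - fps_X ^ i) * (\<Prod>i\<in>{1..m}. 1 - fps_X ^ i))) (theta e w)"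
      unfolding jacobi_finite w_def e_def by (simp only: power_one_right)
    moreover have "fps_eq_upto N (f_ser 1 * ((\<Prod>i\<in>{1..Suc m}. 1 - fps_X ^ (1 * i)) * (\<Prod>i\<in>{1..m}. 1 - fps_X ^ (1 * i)))) (f_ser 1 * (f_ser 1 * f_ser 1))"
      by (intro fps_eq_upto_mult fps_eq_upto_f_ser fps_eq_upto_refl) (auto simp: m_def)
    ultimately show "fps_eq_upto N (theta e w) (f_ser 1 ^ 3)"
      unfolding nat_mult_1 power3_eq_cube mult.assoc by (blast intro: fps_eq_upto_sym fps_eq_upto_trans)
  qed
  ultimately show ?thesis by simp
qed

section \<open>The theta series of f_1^5 / f_2^2\<close>

text \<open>Exponents are doubled to avoid halves. The key is
  \<open>3 (i^2 + 2 j^2) = (i + 2 j)^2 + 2 (i - j)^2\<close>: after the weight \<open>i\<close> is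
  replaced by \<open>i + 2 j\<close>, the class of \<open>i + 2 j\<close> modulo 3 decides the
  outcome. Class 1 cancels, while classes 0 and 2 yield the weights \<open>3 l\<close> and
  \<open>3 l + 1\<close>, which add up to \<open>6 l + 1\<close>.\<close>

lemma quintuple_sum:
  fixes M :: int
  defines "A \<equiv> {(i, j). i * (i + 1) + 2 * (j * j) = M}"
    and "B \<equiv> {(l, j). l * (3 * l + 1) + 2 * (3 * j * j - j) = M}"
  assumes fin: "finite A"
  shows "(\<Sum>(l, j)\<in>B. of_int (6 * l + 1) * altsign j) = (\<Sum>(i, j)\<in>A. altsign i * of_int i * altsign j)"
proof -
  define W where "W = (\<lambda>p. altsign (fst p + snd p) * of_int (fst p + 2 * snd p))"
  define Ac where "Ac = (\<lambda>c. {p \<in> A. (fst p + 2 * snd p) mod 3 = c})"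
  have par: "altsign (x + y) = altsign x * altsign y" for x y
    by (simp add: altsign_def)
  \<comment> \<open>The reflection of \<open>i\<close> to \<open>- 1 - i\<close> preserves
    \<open>A\<close> and reverses the sign, so weights depending on \<open>j\<close> alone sum to 0.
    This permits the replacement of \<open>i\<close> by \<open>i + 2 j\<close> in
    \<open>W\<close>.\<close>
  have j0: "(\<Sum>p\<in>A. altsign (fst p + snd p) * of_int (snd p)) = 0"
  proof -
    have "(\<Sum>p\<in>A. altsign (fst p + snd p) * of_int (snd p)) = (\<Sum>p\<in>A. - (altsign (fst p + snd p) * of_int (snd p)))"
      by (rule sum.reindex_bij_witness[of _ "\<lambda>p. (- 1 - fst p, snd p)" "\<lambda>p. (- 1 - fst p, snd p)"])
         (auto simp: A_def altsign_def algebra_simps)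
    then show ?thesis by (simp add: sum_negf)
  qed
  have "(\<Sum>p\<in>A. W p) = (\<Sum>p\<in>A. altsign (fst p + snd p) * of_int (fst p)) + 2 * (\<Sum>p\<in>A. altsign (fst p + snd p) * of_int (snd p))"
    unfolding sum_distrib_left sum.distrib[symmetric] by (rule sum.cong) (auto simp: W_def algebra_simps)
  also have "(\<Sum>p\<in>A. altsign (fst p + snd p) * of_int (fst p)) = (\<Sum>(i, j)\<in>A. altsign i * of_int i * altsign j)"
    by (rule sum.cong) (auto simp: par)
  finally have all: "(\<Sum>(i, j)\<in>A. altsign i * of_int i * altsign j) = (\<Sum>p\<in>A. W p)"
    using j0 by simp
  have A_split: "A = Ac 0 \<union> Ac 1 \<union> Ac 2"
    unfolding Ac_def by auto
  have split: "(\<Sum>p\<in>A. W p) = (\<Sum>p\<in>Ac 0. W p) + (\<Sum>p\<in>Ac 1. W p) + (\<Sum>p\<in>Ac 2. W p)"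
  proof -
    have f: "finite (Ac c)" for c using fin by (simp add: Ac_def)
    show ?thesis unfolding A_split
      by (subst sum.union_disjoint, use f in \<open>auto simp: Ac_def\<close>)+
  qed
  \<comment> \<open>For fixed \<open>k = i + 2 * j = 3 * l + 1\<close> the form is symmetric under \<open>j \<mapsto> 2 * l + 1 - j\<close>,
    which changes the sign of \<open>W\<close>.\<close>
  have "(\<Sum>p\<in>Ac 1. W p) = (\<Sum>p\<in>Ac 1. - W p)"
  proof -
    \<comment> \<open>This is the reflection in the coordinates \<open>(i, j)\<close>; both
      divisions are exact when \<open>i + 2 * j\<close> is 1 modulo 3.\<close>
    define h where "h = (\<lambda>p :: int \<times> int. ((4 * snd p - fst p - 2) div 3, (2 * fst p + snd p + 1) div 3))"
    have h: "h (h p) = p \<and> h p \<in> Ac 1 \<and> W (h p) = - W p" if p: "p \<in> Ac 1" for p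
    proof -
      obtain i j where ij: "p = (i, j)" by (cases p)
      define l where "l = (i + 2 * j) div 3"
      have "(i + 2 * j) mod 3 = 1" using p ij by (simp add: Ac_def)
      then have i: "i = 3 * l + 1 - 2 * j" unfolding l_def by presburger
      have hp: "h p = (2 * j - l - 1, 2 * l + 1 - j)"
        unfolding h_def ij i by simp
      have "h (h p) = p" unfolding hp unfolding h_def ij i by simp
      moreover have "h p \<in> Ac 1"
        using p unfolding hp unfolding Ac_def A_def ij i by (simp add: algebra_simps)
      moreover have "W (h p) = - W p"
        unfolding hp unfolding W_def ij i by (simp add: altsign_def)
      ultimately show ?thesis by blast
    qed
    show ?thesis by (rule sum.reindex_bij_witness[of _ h h]) (use h in auto)
  qed
  then have one: "(\<Sum>p\<in>Ac 1. W p) = 0" by (simp add: sum_negf)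
  \<comment> \<open>The coordinates on the two other classes come from completing the square, with
    \<open>i + 2 * j\<close> equal to \<open>3 * l\<close> and \<open>- 1 - 3 * l\<close> respectively.\<close>
  have zero: "(\<Sum>p\<in>Ac 0. W p) = (\<Sum>(l, j)\<in>B. of_int (3 * l) * altsign j)"
  proof (rule sum.reindex_bij_witness[of _ "\<lambda>(l, j). (l - 2 * j, j + l)"
        "\<lambda>(i, j). ((i + 2 * j) div 3, j - (i + 2 * j) div 3)"])
    fix p assume p: "p \<in> Ac 0"
    obtain i j where ij: "p = (i, j)" by (cases p)
    define l where "l = (i + 2 * j) div 3"
    have "(i + 2 * j) mod 3 = 0" using p ij by (simp add: Ac_def)
    then have i: "i = 3 * l - 2 * j" unfolding l_def by presburger
    show "(case case p of (i, j) \<Rightarrow> ((i + 2 * j) div 3, j - (i + 2 * j) div 3) of (l, j) \<Rightarrow> (l - 2 * j, j + l)) = p"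
      unfolding ij i by simp
    show "(case p of (i, j) \<Rightarrow> ((i + 2 * j) div 3, j - (i + 2 * j) div 3)) \<in> B"
      using p unfolding ij i Ac_def A_def B_def by (simp add: algebra_simps)
    show "(case case p of (i, j) \<Rightarrow> ((i + 2 * j) div 3, j - (i + 2 * j) div 3) of (l, j) \<Rightarrow> of_int (3 * l) * altsign j) = W p"
      unfolding ij i W_def by (simp add: altsign_def)
  next
    fix p assume p: "p \<in> B"
    obtain l j where lj: "p = (l, j)" by (cases p)
    show "(case case p of (l, j) \<Rightarrow> (l - 2 * j, j + l) of (i, j) \<Rightarrow> ((i + 2 * j) div 3, j - (i + 2 * j) div 3)) = p"
      unfolding lj by simp
    show "(case p of (l, j) \<Rightarrow> (l - 2 * j, j + l)) \<in> Ac 0"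
      using p unfolding lj Ac_def A_def B_def by (simp add: algebra_simps)
  qed
  have two: "(\<Sum>p\<in>Ac 2. W p) = (\<Sum>(l, j)\<in>B. of_int (3 * l + 1) * altsign j)"
  proof (rule sum.reindex_bij_witness[of _ "\<lambda>(l, j). (2 * j - l - 1, - j - l)"
        "\<lambda>(i, j). ((- 1 - i - 2 * j) div 3, - j - (- 1 - i - 2 * j) div 3)"])
    fix p assume p: "p \<in> Ac 2"
    obtain i j where ij: "p = (i, j)" by (cases p)
    define l where "l = (- 1 - i - 2 * j) div 3"
    have "(i + 2 * j) mod 3 = 2" using p ij by (simp add: Ac_def)
    then have i: "i = - 1 - 3 * l - 2 * j" unfolding l_def by presburger
    show "(case case p of (i, j) \<Rightarrow> ((- 1 - i - 2 * j) div 3, - j - (- 1 - i - 2 * j) div 3) of (l, j) \<Rightarrow> (2 * j - l - 1, - j - l)) = p"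
      unfolding ij i by simp
    show "(case p of (i, j) \<Rightarrow> ((- 1 - i - 2 * j) div 3, - j - (- 1 - i - 2 * j) div 3)) \<in> B"
      using p unfolding ij i Ac_def A_def B_def by (simp add: algebra_simps)
    show "(case case p of (i, j) \<Rightarrow> ((- 1 - i - 2 * j) div 3, - j - (- 1 - i - 2 * j) div 3) of (l, j) \<Rightarrow> of_int (3 * l + 1) * altsign j) = W p"
      unfolding ij i W_def by (simp add: altsign_def)
  next
    fix p assume p: "p \<in> B"
    obtain l j where lj: "p = (l, j)" by (cases p)
    show "(case case p of (l, j) \<Rightarrow> (2 * j - l - 1, - j - l) of (i, j) \<Rightarrow> ((- 1 - i - 2 * j) div 3, - j - (- 1 - i - 2 * j) div 3)) = p"
      unfolding lj by simp
    have "(- 1 - 3 * l) mod 3 = 2" by presburger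
    then show "(case p of (l, j) \<Rightarrow> (2 * j - l - 1, - j - l)) \<in> Ac 2"
      using p unfolding lj Ac_def A_def B_def by (simp add: algebra_simps)
  qed
  have "(\<Sum>(l, j)\<in>B. of_int (6 * l + 1) * altsign j)
      = (\<Sum>(l, j)\<in>B. of_int (3 * l) * altsign j) + (\<Sum>(l, j)\<in>B. of_int (3 * l + 1) * altsign j)"
    unfolding sum.distrib[symmetric] by (rule sum.cong) (auto simp: algebra_simps)
  then show ?thesis using all split zero one two by simp
qed

lemma nat_half_eq_iff:
  fixes x :: int
  assumes "even x" "0 \<le> x"
  shows "nat (x div 2) + n = N \<longleftrightarrow> x + 2 * int n = 2 * int N"
  using assms by (auto elim!: evenE)

text \<open>Comparing coefficients of \<open>G * f_2\<close> and
  \<open>f_1^3 * (f_1^2 / f_2)\<close>, the latter quotient in its theta form, reduces the identity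
  to \<open>quintuple_sum\<close>. Gauss's identity absorbs the second factor
  \<open>f_2\<close>.\<close>

lemma quintuple_product:
  "theta (\<lambda>l. nat (l * (3 * l + 1) div 2)) (\<lambda>l. of_int (6 * l + 1)) * f_ser 2 ^ 2 = f_ser 1 ^ 5"
proof -
  define G where "G = theta (\<lambda>l. nat (l * (3 * l + 1) div 2)) (\<lambda>l. of_int (6 * l + 1))"
  have pos: "0 \<le> l * (3 * l + 1)" "0 \<le> 3 * l * l - l" "\<bar>l\<bar> \<le> 3 * l * l - l"
      "0 \<le> l * (l + 1)" "0 \<le> l * l" for l :: int
    using int_abs_le_square[of l] by (auto simp: algebra_simps abs_if split: if_splits)
  have ev: "even (l * (3 * l + 1))" "even (l * (l + 1))" for l :: int by auto
  have fin: "finite {l. nat (l * (3 * l + 1) div 2) = N}" "finite {j. nat (3 * j * j - j) = N}"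
    "finite {i. nat (i * (i + 1) div 2) = N}" "finite {j. nat (j * j) = N}" for N
  proof -
    show "finite {l. nat (l * (3 * l + 1) div 2) = N}"
    proof (rule finite_fibre)
      fix l :: int
      have "0 \<le> 3 * (l * l) - \<bar>l\<bar>" using int_abs_le_square[of l] by linarith
      then have "2 * \<bar>l\<bar> \<le> l * (3 * l + 1) + 2"
        using int_abs_le_square[of l] by (simp add: algebra_simps abs_if split: if_splits)
      then show "\<bar>l\<bar> \<le> int (nat (l * (3 * l + 1) div 2)) + 1" by linarith
    qed
    show "finite {j. nat (3 * j * j - j) = N}"
      by (rule finite_fibre) (use pos(3) in \<open>smt (verit) nat_0_le pos(2)\<close>)
    show "finite {i. nat (i * (i + 1) div 2) = N}"
    proof (rule finite_fibre)
      fix i :: int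
      show "\<bar>i\<bar> \<le> int (nat (i * (i + 1) div 2)) + 1"
        using int_bound_triangle[of "- i"] by (simp add: algebra_simps)
    qed
    show "finite {j. nat (j * j) = N}"
      by (rule finite_fibre) (use int_abs_le_square in \<open>smt (verit) nat_0_le pos(5)\<close>)
  qed
  have "G * f_ser 2 = f_ser 1 ^ 3 * theta (\<lambda>j. nat (j * j)) altsign"
    unfolding G_def euler_pentagonal[symmetric] jacobi_cube[symmetric]
      theta_mult[OF fin(1,2)] theta_mult[OF fin(3,4)]
  proof (rule fps_ext)
    fix N
    have "nat (i * (i + 1) div 2) + nat (j * j) = N \<longleftrightarrow> i * (i + 1) + 2 * (j * j) = 2 * int N" for i j :: int
      using nat_half_eq_iff[OF ev(2) pos(4), of i "nat (j * j)" N] by simp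
    then have A: "{p. (case p of (i, j) \<Rightarrow> nat (i * (i + 1) div 2) + nat (j * j)) = N}
        = {(i, j). i * (i + 1) + 2 * (j * j) = 2 * int N}"
      by (simp only: case_prod_unfold)
    have "nat (l * (3 * l + 1) div 2) + nat (3 * j * j - j) = N \<longleftrightarrow> l * (3 * l + 1) + 2 * (3 * j * j - j) = 2 * int N" for l j :: int
      using nat_half_eq_iff[OF ev(1) pos(1), of l "nat (3 * j * j - j)" N] pos(2)[of j] by simp
    then have B: "{p. (case p of (l, j) \<Rightarrow> nat (l * (3 * l + 1) div 2) + nat (3 * j * j - j)) = N}
        = {(l, j). l * (3 * l + 1) + 2 * (3 * j * j - j) = 2 * int N}"
      by (simp only: case_prod_unfold)
    have "finite {(i, j). i * (i + 1) + 2 * (j * j) = 2 * int N}"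
    proof (rule finite_subset)
      show "{(i, j). i * (i + 1) + 2 * (j * j) = 2 * int N} \<subseteq>
        (\<Union>k\<le>N. {i. nat (i * (i + 1) div 2) = k}) \<times> (\<Union>k\<le>N. {j. nat (j * j) = k})"
        unfolding A[symmetric] by auto
      show "finite ((\<Union>k\<le>N. {i. nat (i * (i + 1) div 2) = k}) \<times> (\<Union>k\<le>N. {j. nat (j * j) = k}))"
        using fin(3,4) by blast
    qed
    from quintuple_sum[OF this]
    show "fps_nth (theta (\<lambda>(l, j). nat (l * (3 * l + 1) div 2) + nat (3 * j * j - j)) (\<lambda>(l, j). of_int (6 * l + 1) * altsign j)) N
      = fps_nth (theta (\<lambda>(i, j). nat (i * (i + 1) div 2) + nat (j * j)) (\<lambda>(i, j). altsign i * of_int i * altsign j)) N"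
      unfolding theta_def fps_nth_Abs_fps A B .
  qed
  then have "G * f_ser 2 ^ 2 = f_ser 1 ^ 3 * (theta (\<lambda>j. nat (j * j)) altsign * f_ser 2)"
    by (simp add: power2_eq_square mult_ac)
  also have "\<dots> = f_ser 1 ^ 5"
    unfolding gauss_square by (simp flip: power_add)
  finally show ?thesis unfolding G_def .
qed

section \<open>Integral power series and the congruence modulo p\<close>

definition int_fps :: "rat fps \<Rightarrow> bool" where
  "int_fps f \<longleftrightarrow> (\<forall>n. fps_nth f n \<in> \<int>)"

lemma int_fps_mult: "int_fps f \<Longrightarrow> int_fps g \<Longrightarrow> int_fps (f * g)"
  by (auto simp: int_fps_def fps_mult_nth intro!: Ints_sum Ints_mult)

lemma int_fps_power: "int_fps f \<Longrightarrow> int_fps (f ^ k)"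
  by (induction k) (auto intro: int_fps_mult simp: int_fps_def[of 1])

lemma int_fps_f_ser: "int_fps (f_ser r)"
proof -
  have "int_fps (1 - fps_X ^ k)" for k
    by (auto simp: int_fps_def)
  then have "int_fps (\<Prod>i\<in>{1..n}. 1 - fps_X ^ (r * i))" for n
    by (induction n) (auto intro: int_fps_mult simp: int_fps_def[of 1])
  then show ?thesis by (simp add: int_fps_def f_ser_def)
qed

text \<open>A constant coefficient 1 makes the convolution recurrence for the inverse free of
  division.\<close>

lemma int_fps_inverse:
  assumes "int_fps f" "fps_nth f 0 = 1"
  shows "int_fps (inverse f)"
proof -
  have "fps_nth (inverse f) n \<in> \<int>" for n
  proof (induction n rule: less_induct)
    case (less n)
    show ?case
    proof (cases "n = 0")
      case False
      have "fps_nth (f * inverse f) n = 0"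
        using inverse_mult_eq_1'[of f] assms(2) False by simp
      then have "fps_nth (inverse f) n = - (\<Sum>i=1..n. fps_nth f i * fps_nth (inverse f) (n - i))"
        unfolding fps_mult_nth using assms(2) by (simp add: sum.atLeast_Suc_atMost)
      also have "\<dots> \<in> \<int>"
        using assms(1) less by (intro Ints_minus Ints_sum Ints_mult) (auto simp: int_fps_def)
      finally show ?thesis .
    qed (use assms in simp)
  qed
  then show ?thesis by (simp add: int_fps_def)
qed

text \<open>Differentiating \<open>f^p\<close> shows that \<open>m\<close> times the coefficient is
  \<open>p\<close> times an integer, and the prime \<open>p\<close> does not divide
  \<open>m\<close>.\<close>

lemma int_fps_power_prime_nth:
  fixes p m :: nat
  assumes "int_fps f" "prime p" "\<not> p dvd m"
  shows "\<exists>z::int. fps_nth (f ^ p) m = of_int (int p * z)"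
proof -
  obtain k where m: "m = Suc k" using assms(3) by (cases m) auto
  define g where "g = f ^ (p - 1) * fps_deriv f"
  have "int_fps (fps_deriv f)"
    using assms(1) by (auto simp: int_fps_def intro!: Ints_mult Ints_add)
  then have "fps_nth g k \<in> \<int>"
    using int_fps_mult[OF int_fps_power[OF assms(1)]] unfolding g_def int_fps_def by blast
  then obtain a :: int where a: "fps_nth g k = of_int a" by (auto elim: Ints_cases)
  have "fps_nth (f ^ p) m \<in> \<int>" using int_fps_power[OF assms(1)] by (simp add: int_fps_def)
  then obtain b :: int where b: "fps_nth (f ^ p) m = of_int b" by (auto elim: Ints_cases)
  have "fps_deriv (f ^ p) = of_nat p * g"
    unfolding g_def by (simp add: fps_deriv_power fps_of_nat mult_ac)
  then have "of_nat m * fps_nth (f ^ p) m = of_nat p * fps_nth g k"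
    using fps_deriv_nth[of "f ^ p" k] m by (simp add: fps_mult_of_nat_nth)
  then have "of_int (int m * b) = (of_int (int p * a) :: rat)"
    using a b by simp
  then have "int m * b = int p * a" by (simp only: of_int_eq_iff)
  then have "int p dvd int m * b" by simp
  then have "int p dvd b"
    using assms(2,3) by (metis int_dvd_int_iff prime_dvd_mult_iff prime_nat_int_transfer)
  then show ?thesis using b by (auto elim!: dvdE)
qed

theorem theorem4p1:
  fixes p :: nat and r :: int
  assumes "prime p" and "p \<ge> 5"
    and "1 \<le> r" and "r \<le> int p - 1"
    and "Legendre (24 * r + 1) (int p) = -1"
  shows "\<forall>n::nat. \<exists>m::int. d_coeff (p - 2) (p * n + nat r) = of_int (int p * m)"
proof
  fix n
  define G where "G = theta (\<lambda>l. nat (l * (3 * l + 1) div 2)) (\<lambda>l. of_int (6 * l + 1))"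
  define u where "u = inverse (f_ser 1)"
  define H where "H = f_ser 2 * u ^ 3"
  define M where "M = p * n + nat r"
  \<comment> \<open>Writing \<open>p = k + 2\<close> removes the truncated subtraction; the
    exponents then meet as \<open>(3 k + 1) + 5 = 3 p\<close>.\<close>
  obtain k where k: "p = k + 2" using assms(2) by (intro that[of "p - 2"]) simp
  have fu: "f_ser 1 * u = 1" unfolding u_def by (rule inverse_mult_eq_1') simp
  have "f_ser 2 ^ (p - 2) / f_ser 1 ^ (3 * (p - 2) + 1) = f_ser 2 ^ k * u ^ (3 * k + 1)"
    unfolding u_def k by (subst fps_divide_unit) (auto simp: fps_nth_power_0 fps_inverse_power simp del: power_Suc)
  \<comment> \<open>A factor 1 is inserted: its part \<open>f_1^5\<close> becomes
    \<open>G * f_2^2\<close>, and its part \<open>u^5\<close> completes the exponent of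
    \<open>u\<close> to \<open>3 p\<close>.\<close>
  also have "\<dots> = f_ser 2 ^ k * u ^ (3 * k + 1) * (f_ser 1 * u) ^ 5"
    unfolding fu by simp
  also have "\<dots> = f_ser 2 ^ k * u ^ (3 * k + 1) * u ^ 5 * (G * f_ser 2 ^ 2)"
    unfolding G_def quintuple_product by (simp only: power_mult_distrib mult_ac)
  also have "\<dots> = G * ((f_ser 2 ^ k * f_ser 2 ^ 2) * (u ^ (3 * k + 1) * u ^ 5))"
    by (simp only: mult_ac)
  also have "f_ser 2 ^ k * f_ser 2 ^ 2 = f_ser 2 ^ (k + 2)"
    by (simp only: power_add)
  also have "u ^ (3 * k + 1) * u ^ 5 = u ^ (3 * (k + 2))"
    unfolding power_add[symmetric] by simp
  also have "G * (f_ser 2 ^ (k + 2) * u ^ (3 * (k + 2))) = G * H ^ p"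
    unfolding H_def k power_mult_distrib power_mult ..
  finally have d: "d_coeff (p - 2) M = (\<Sum>i=0..M. fps_nth G i * fps_nth (H ^ p) (M - i))"
    unfolding d_coeff_def by (simp add: fps_mult_nth)
  have H: "int_fps H"
    unfolding H_def u_def by (intro int_fps_mult int_fps_power int_fps_inverse int_fps_f_ser) simp
  have "\<exists>z::int. fps_nth G i * fps_nth (H ^ p) (M - i) = of_int (int p * z)" if i: "i \<le> M" for i
  \<comment> \<open>If \<open>p\<close> divides \<open>M - i\<close>, then \<open>i\<close> is
    congruent to \<open>r\<close> and the coefficient of \<open>G\<close> vanishes; otherwise the
    coefficient of \<open>H^p\<close> supplies the factor \<open>p\<close>.\<close>
  proof (cases "p dvd M - i")
    case True
    have "{l. nat (l * (3 * l + 1) div 2) = i} = {}"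
    proof (rule ccontr)
      assume "{l. nat (l * (3 * l + 1) div 2) = i} \<noteq> {}"
      then obtain l :: int where l: "nat (l * (3 * l + 1) div 2) = i" by auto
      have "0 \<le> l * (3 * l + 1)"
        using int_abs_le_square[of l] by (auto simp: algebra_simps abs_if split: if_splits)
      moreover have "even (l * (3 * l + 1))" by auto
      ultimately have l': "l * (3 * l + 1) = 2 * int i"
        using nat_half_eq_iff[of "l * (3 * l + 1)" 0 i] l by simp
      have "int p dvd int M - int i"
        using True i by (metis int_dvd_int_iff of_nat_diff)
      moreover have "int M = int p * int n + r" using assms(3) by (simp add: M_def)
      ultimately have "int p dvd r - int i"
        by (metis add_diff_eq dvd_add_right_iff dvd_triv_left)
      then have "int p dvd 24 * (int i - r)"
        by (metis dvd_diff_commute dvd_mult)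
      \<comment> \<open>Completing the square in \<open>l (3 l + 1) = 2 i\<close> gives
        \<open>24 i + 1 = (6 l + 1)^2\<close>, which would make \<open>24 r + 1\<close> a quadratic
        residue.\<close>
      moreover have "24 * (int i - r) = (6 * l + 1) ^ 2 - (24 * r + 1)"
        using l' by (simp add: power2_eq_square algebra_simps)
      ultimately have "[(6 * l + 1) ^ 2 = 24 * r + 1] (mod int p)"
        unfolding cong_iff_dvd_diff by (simp only:)
      then have "QuadRes (int p) (24 * r + 1)" unfolding QuadRes_def by blast
      then show False using assms(5) by (auto simp: Legendre_def split: if_splits)
    qed
    then have "fps_nth G i = 0" by (simp add: G_def theta_def)
    then show ?thesis by (intro exI[of _ 0]) simp
  next
    case False
    obtain z where z: "fps_nth (H ^ p) (M - i) = of_int (int p * z)"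
      using int_fps_power_prime_nth[OF H assms(1) False] by blast
    have "fps_nth G i = of_int (\<Sum>l\<in>{l. nat (l * (3 * l + 1) div 2) = i}. 6 * l + 1)"
      by (simp add: G_def theta_def)
    then show ?thesis unfolding z
      by (intro exI[of _ "(\<Sum>l\<in>{l. nat (l * (3 * l + 1) div 2) = i}. 6 * l + 1) * z"]) simp
  qed
  then obtain z :: "nat \<Rightarrow> int" where
    "\<And>i. i \<le> M \<Longrightarrow> fps_nth G i * fps_nth (H ^ p) (M - i) = of_int (int p * z i)" by metis
  then have "d_coeff (p - 2) M = of_int (int p * (\<Sum>i=0..M. z i))"
    unfolding d by (simp add: sum_distrib_left)
  then show "\<exists>m::int. d_coeff (p - 2) (p * n + nat r) = of_int (int p * m)"
    unfolding M_def by blast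
qed

end
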